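(* Let $r\geq 4$ be even and let $H$ be $K_r$ with a rotated edge. Then for any integer $t\geq\binom{r}{2}$, $\operatorname{sat}_t(n,\mathfrak{R}(H))=O(n)$ as $n\to\infty$.
   Context: "$K_r$ with a rotated edge" is obtained from a copy of $K_r$ by adding one new vertex $w$ and replacing one edge $uv$ of the clique by the edge $uw$. A $t$-edge-coloured graph is a graph $G$ with a function $c:E(G)\to\{1,\dots,t\}$ (not necessarily proper). A copy of $H$ is rainbow if all its edges receive distinct colours; $\mathfrak{R}(H)$ denotes the family of rainbow copies of $H$. A $t$-edge-coloured graph is $\mathfrak{R}(H)$-saturated if it contains no rainbow copy of $H$ but adding any non-edge in any colour from $\{1,\dots,t\}$ creates a rainbow copy of $H$. $\operatorname{sat}_t(n,\mathfrak{R}(H))$ is the minimum number of edges of such a graph on $n$ vertices. *)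

theory Defs
  imports "HOL-Library.Ramsey" "HOL-Library.Landau_Symbols"
begin

type_synonym 'a ugraph = "'a set \<times> 'a set set"

abbreviation verts :: "'a ugraph \<Rightarrow> 'a set" where "verts G \<equiv> fst G"
abbreviation edges :: "'a ugraph \<Rightarrow> 'a set set" where "edges G \<equiv> snd G"

definition simple_graph :: "'a ugraph \<Rightarrow> bool" where
  "simple_graph G \<longleftrightarrow> finite (verts G) \<and> edges G \<subseteq> [verts G]\<^bsup>2\<^esup>"

definition subgraph :: "'a ugraph \<Rightarrow> 'a ugraph \<Rightarrow> bool" where
  "subgraph K G \<longleftrightarrow> verts K \<subseteq> verts G \<and> edges K \<subseteq> edges G"

definition isomorphic :: "'b ugraph \<Rightarrow> 'a ugraph \<Rightarrow> bool" where
  "isomorphic H K \<longleftrightarrow>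
    (\<exists>f. bij_betw f (verts H) (verts K) \<and> edges K = (\<lambda>e. f ` e) ` edges H)"

definition rotated_clique :: "nat \<Rightarrow> 'b ugraph \<Rightarrow> bool" where
  "rotated_clique r H \<longleftrightarrow>
    (\<exists>K u v w. finite K \<and> card K = r \<and> u \<in> K \<and> v \<in> K \<and> u \<noteq> v \<and> w \<notin> K \<and>
      H = (insert w K, ([K]\<^bsup>2\<^esup> - {{u, v}}) \<union> {{u, w}}))"

text \<open>A colouring is a total function on sets; only its values on the edges of the graph matter.\<close>

definition edge_coloured :: "nat \<Rightarrow> 'a ugraph \<Rightarrow> ('a set \<Rightarrow> nat) \<Rightarrow> bool" where
  "edge_coloured t G c \<longleftrightarrow> simple_graph G \<and> c ` edges G \<subseteq> {1..t}"

definition has_rainbow_copy :: "'b ugraph \<Rightarrow> 'a ugraph \<Rightarrow> ('a set \<Rightarrow> nat) \<Rightarrow> bool" where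
  "has_rainbow_copy H G c \<longleftrightarrow>
    (\<exists>K. subgraph K G \<and> isomorphic H K \<and> inj_on c (edges K))"

definition rainbow_saturated ::
    "nat \<Rightarrow> 'b ugraph \<Rightarrow> 'a ugraph \<Rightarrow> ('a set \<Rightarrow> nat) \<Rightarrow> bool" where
  "rainbow_saturated t H G c \<longleftrightarrow>
    edge_coloured t G c \<and> \<not> has_rainbow_copy H G c \<and>
    (\<forall>e \<in> [verts G]\<^bsup>2\<^esup> - edges G. \<forall>i \<in> {1..t}.
       has_rainbow_copy H (verts G, insert e (edges G)) (c(e := i)))"

definition sat :: "nat \<Rightarrow> nat \<Rightarrow> 'b ugraph \<Rightarrow> nat" where
  "sat t n H =
    (LEAST m. \<exists>(G :: nat ugraph) c.
       card (verts G) = n \<and> rainbow_saturated t H G c \<and> card (edges G) = m)"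

text \<open>The minimum is over a nonempty set whenever \<open>H\<close> has an edge, so the value of
  \<open>LEAST\<close> is always attained.\<close>

lemma rainbow_saturated_exists:
  assumes "edges H \<noteq> {}"
  shows "\<exists>(G :: nat ugraph) c. card (verts G) = n \<and> rainbow_saturated t H G c"
proof -
  define V where "V = {..<n}"
  define P where "P m \<longleftrightarrow> (\<exists>E c. edge_coloured t (V, E) c \<and> \<not> has_rainbow_copy H (V, E) c
    \<and> card E = m)" for m
  have fin: "finite ([V]\<^bsup>2\<^esup>)"
    unfolding V_def by (simp add: finite_imp_finite_nsets)
  have "P 0"
    unfolding P_def
    using assms by (intro exI[of _ "{}"])
      (auto simp: edge_coloured_def simple_graph_def V_def has_rainbow_copy_def
        subgraph_def isomorphic_def)
  moreover have bound: "m \<le> card ([V]\<^bsup>2\<^esup>)" if "P m" for m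
    using that fin unfolding P_def edge_coloured_def simple_graph_def
    by (auto simp del: card_nsets intro: card_mono)
  ultimately have "P (Greatest P)"
    by (metis GreatestI_nat)
  have max: "m \<le> Greatest P" if "P m" for m
    using that bound by (rule Greatest_le_nat)
  from \<open>P (Greatest P)\<close> obtain E c where E: "edge_coloured t (V, E) c" "\<not> has_rainbow_copy H (V, E) c"
      "card E = Greatest P"
    unfolding P_def by blast
  have "has_rainbow_copy H (V, insert e E) (c(e := i))"
    if e: "e \<in> [V]\<^bsup>2\<^esup> - E" and i: "i \<in> {1..t}" for e i
  proof (rule ccontr)
    assume neg: "\<not> ?thesis"
    have "edge_coloured t (V, insert e E) (c(e := i))"
      using E(1) e i by (auto simp: edge_coloured_def simple_graph_def)
    then have "P (card (insert e E))"
      unfolding P_def using neg by blast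
    moreover have "finite E"
      using E(1) fin by (auto simp: edge_coloured_def simple_graph_def intro: finite_subset)
    ultimately show False
      using max[of "card (insert e E)"] E(3) e by simp
  qed
  with E have "rainbow_saturated t H (V, E) c"
    by (simp add: rainbow_saturated_def)
  then show ?thesis
    by (intro exI[of _ "(V, E)"] exI[of _ c]) (simp add: V_def)
qed

lemma sat_attained:
  assumes "edges H \<noteq> {}"
  shows "\<exists>(G :: nat ugraph) c.
    card (verts G) = n \<and> rainbow_saturated t H G c \<and> card (edges G) = sat t n H"
  unfolding sat_def by (rule LeastI_ex) (use rainbow_saturated_exists[OF assms] in blast)

end

(* Every point of a suitable linear space with lines of size r lies on r/2 lines, and each line is a
   rainbow clique using all r choose 2 colours. If the colouring is proper, then every point sees
   every colour exactly once, because r/2 * (r - 1) = r choose 2; this is where r has to be even. If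
   moreover all triangles lie in lines, then the collinearity graph has no rainbow copy of H, yet every
   new edge xy of colour i at a point x creates one: take the line through the edge of colour i at x,
   delete that edge and use xy as the pendant edge. Hence disjoint copies of this fixed graph can be
   added to any saturated graph, and each adds a constant number of vertices and of edges. *)

theory Submission
  imports Defs "HOL-Number_Theory.Cong"
begin

section \<open>Rotated cliques\<close>

definition rotated_edges :: "'a set \<Rightarrow> 'a \<Rightarrow> 'a \<Rightarrow> 'a \<Rightarrow> 'a set set" where
  "rotated_edges K u v w = ([K]\<^bsup>2\<^esup> - {{u, v}}) \<union> {{u, w}}"

lemma rotated_clique_altdef:
  "rotated_clique r H \<longleftrightarrow>
    (\<exists>K u v w. finite K \<and> card K = r \<and> u \<in> K \<and> v \<in> K \<and> u \<noteq> v \<and> w \<notin> K \<and>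
      H = (insert w K, rotated_edges K u v w))"
  by (simp add: rotated_clique_def rotated_edges_def)

lemma image_rotated_edges:
  assumes "inj_on f (insert w K)" "u \<in> K" "v \<in> K" "w \<notin> K"
  shows "(\<lambda>e. f ` e) ` rotated_edges K u v w = rotated_edges (f ` K) (f u) (f v) (f w)"
proof -
  have inj: "inj_on f K"
    using assms(1) by (rule inj_on_subset) auto
  have nsets: "(\<lambda>e. f ` e) ` [K]\<^bsup>2\<^esup> = [f ` K]\<^bsup>2\<^esup>"
    using bij_betw_nsets[of f K "f ` K" 2] inj by (simp add: bij_betw_def)
  have "(\<lambda>e. f ` e) ` ([K]\<^bsup>2\<^esup> - {{u, v}}) = (\<lambda>e. f ` e) ` [K]\<^bsup>2\<^esup> - (\<lambda>e. f ` e) ` {{u, v}}"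
  proof (rule inj_on_image_set_diff)
    show "inj_on (\<lambda>e. f ` e) (Pow K)"
      using inj by (rule inj_on_image_Pow)
  qed (use assms in \<open>auto simp: nsets_def\<close>)
  then show ?thesis
    by (simp add: rotated_edges_def nsets image_Un)
qed

text \<open>Up to isomorphism only \<open>r\<close> matters: any bijection between the vertices
  other than \<open>u\<close>, \<open>v\<close>, \<open>w\<close> and those other than
  \<open>u'\<close>, \<open>v'\<close>, \<open>w'\<close> extends to an isomorphism that matches
  these three in order.\<close>

lemma isomorphic_rotated_clique_iff:
  assumes "rotated_clique r H"
  shows "isomorphic H K \<longleftrightarrow> rotated_clique r K"
proof
  obtain A u v w where A: "finite A" "card A = r" "u \<in> A" "v \<in> A" "u \<noteq> v" "w \<notin> A"
    and H: "H = (insert w A, rotated_edges A u v w)"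
    using assms unfolding rotated_clique_altdef by blast
  {
    assume "isomorphic H K"
    then obtain f where f: "bij_betw f (insert w A) (verts K)"
      and E: "edges K = (\<lambda>e. f ` e) ` rotated_edges A u v w"
      unfolding isomorphic_def H by auto
    have inj: "inj_on f (insert w A)"
      using f by (simp add: bij_betw_def)
    then have inj': "inj_on f A"
      by (rule inj_on_subset) auto
    have "K = (insert (f w) (f ` A), rotated_edges (f ` A) (f u) (f v) (f w))"
      using f E image_rotated_edges[OF inj A(3,4,6)]
      by (metis bij_betw_imp_surj_on image_insert prod.collapse)
    moreover have "card (f ` A) = r"
      using A(2) inj' by (simp add: card_image)
    moreover have "f u \<noteq> f v" "f w \<notin> f ` A"
      using inj A by (auto simp: inj_on_def)
    ultimately show "rotated_clique r K"
      unfolding rotated_clique_altdef using A by blast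
  next
    assume "rotated_clique r K"
    then obtain B u' v' w' where B: "finite B" "card B = r" "u' \<in> B" "v' \<in> B" "u' \<noteq> v'" "w' \<notin> B"
      and K: "K = (insert w' B, rotated_edges B u' v' w')"
      unfolding rotated_clique_altdef by blast
    have "card (A - {u, v}) = card (B - {u', v'})"
      using A B by (simp add: card_Diff_subset)
    then obtain g where g: "bij_betw g (A - {u, v}) (B - {u', v'})"
      using A(1) B(1) finite_same_card_bij by blast
    define f where "f = g(u := u', v := v', w := w')"
    have f: "f u = u'" "f v = v'" "f w = w'"
      using A by (auto simp: f_def)
    have "bij_betw f (A - {u, v}) (B - {u', v'})"
      using g A by (subst bij_betw_cong[where g = g]) (auto simp: f_def)
    moreover have "bij_betw f {u, v, w} {u', v', w'}"
      using f A B by (auto simp: bij_betw_def inj_on_def)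
    ultimately have "bij_betw f ((A - {u, v}) \<union> {u, v, w}) ((B - {u', v'}) \<union> {u', v', w'})"
      by (rule bij_betw_combine) (use B in auto)
    moreover have "(A - {u, v}) \<union> {u, v, w} = insert w A" "(B - {u', v'}) \<union> {u', v', w'} = insert w' B"
      using A B by auto
    ultimately have bij: "bij_betw f (insert w A) (insert w' B)"
      by simp
    have "f ` A = B"
      using bij A(6) B(6) f(3) by (auto simp: bij_betw_def inj_on_def)
    then have "(\<lambda>e. f ` e) ` rotated_edges A u v w = rotated_edges B u' v' w'"
      using image_rotated_edges[of f w A u v] bij A f by (simp add: bij_betw_def)
    then show "isomorphic H K"
      unfolding isomorphic_def H K using bij by auto
  }
qed

text \<open>Replaces isomorphisms by vertices of the host graph, so that later arguments can speak
  of \<open>L\<close>, \<open>u\<close>, \<open>v\<close>, \<open>w\<close> directly. The pair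
  \<open>{u, v}\<close> may or may not be an edge of \<open>G\<close>.\<close>

lemma has_rainbow_copy_rotated_iff:
  assumes "rotated_clique r H"
  shows "has_rainbow_copy H G c \<longleftrightarrow>
    (\<exists>L u v w. finite L \<and> card L = r \<and> u \<in> L \<and> v \<in> L \<and> u \<noteq> v \<and> w \<notin> L \<and>
      insert w L \<subseteq> verts G \<and> rotated_edges L u v w \<subseteq> edges G \<and> inj_on c (rotated_edges L u v w))"
    (is "_ \<longleftrightarrow> ?copy")
proof
  assume "has_rainbow_copy H G c"
  then obtain K where "rotated_clique r K" and K: "subgraph K G" "inj_on c (edges K)"
    unfolding has_rainbow_copy_def isomorphic_rotated_clique_iff[OF assms] by blast
  then obtain L u v w where L: "finite L" "card L = r" "u \<in> L" "v \<in> L" "u \<noteq> v" "w \<notin> L"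
    and "K = (insert w L, rotated_edges L u v w)"
    unfolding rotated_clique_altdef by blast
  then have "insert w L \<subseteq> verts G" "rotated_edges L u v w \<subseteq> edges G"
    "inj_on c (rotated_edges L u v w)"
    using K by (simp_all add: subgraph_def)
  with L show ?copy by blast
next
  assume ?copy
  then obtain L u v w where L: "finite L" "card L = r" "u \<in> L" "v \<in> L" "u \<noteq> v" "w \<notin> L"
    and G: "insert w L \<subseteq> verts G" "rotated_edges L u v w \<subseteq> edges G"
    and inj: "inj_on c (rotated_edges L u v w)"
    by blast
  have "rotated_clique r (insert w L, rotated_edges L u v w)"
    unfolding rotated_clique_altdef using L by blast
  then show "has_rainbow_copy H G c"
    unfolding has_rainbow_copy_def isomorphic_rotated_clique_iff[OF assms]
    using G inj by (intro exI[of _ "(insert w L, rotated_edges L u v w)"]) (simp add: subgraph_def)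
qed

text \<open>A rotated clique is connected: a vertex \<open>p\<close> of \<open>L\<close> other than
  \<open>u\<close> and \<open>v\<close> keeps its edges to all of \<open>L\<close>, and
  \<open>w\<close> hangs at \<open>u\<close>. Hence it cannot be spread over two vertex-disjoint
  graphs.\<close>

lemma rotated_edges_subset_Un:
  assumes "r \<ge> 4" "card L = r" "u \<in> L" "v \<in> L" "u \<noteq> v" "w \<notin> L"
    and E: "E1 \<subseteq> [V1]\<^bsup>2\<^esup>" "E2 \<subseteq> [V2]\<^bsup>2\<^esup>" "V1 \<inter> V2 = {}"
    and sub: "rotated_edges L u v w \<subseteq> E1 \<union> E2"
  shows "insert w L \<subseteq> V1 \<and> rotated_edges L u v w \<subseteq> E1 \<or>
    insert w L \<subseteq> V2 \<and> rotated_edges L u v w \<subseteq> E2"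
proof -
  have same_side: "x \<in> V1 \<longleftrightarrow> y \<in> V1" "x \<in> V2 \<longleftrightarrow> y \<in> V2" "x \<in> V1 \<union> V2"
    if "{x, y} \<in> E1 \<union> E2" for x y
  proof -
    have "{x, y} \<in> [V1]\<^bsup>2\<^esup> \<or> {x, y} \<in> [V2]\<^bsup>2\<^esup>"
      using that E(1,2) by blast
    then show "x \<in> V1 \<longleftrightarrow> y \<in> V1" "x \<in> V2 \<longleftrightarrow> y \<in> V2" "x \<in> V1 \<union> V2"
      using E(3) by auto
  qed
  have "\<not> L \<subseteq> {u, v}"
    using assms(1,2,5) card_mono[of "{u, v}" L] by auto
  then obtain p where p: "p \<in> L" "p \<noteq> u" "p \<noteq> v"
    by blast
  have "{p, z} \<in> E1 \<union> E2" if "z \<in> L" "z \<noteq> p" for z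
    using sub that p by (intro subsetD[OF sub]) (auto simp: rotated_edges_def doubleton_eq_iff)
  moreover have "{u, w} \<in> E1 \<union> E2"
    using sub by (auto simp: rotated_edges_def)
  ultimately have side: "insert w L \<subseteq> V1 \<or> insert w L \<subseteq> V2"
    using same_side p assms(3) by (metis Un_iff insert_iff subsetI)
  have e: "e \<subseteq> insert w L" "e \<noteq> {}" if "e \<in> rotated_edges L u v w" for e
    using that assms(3,4) by (auto simp: rotated_edges_def nsets_def)
  have E': "e \<subseteq> V1" if "e \<in> E1" for e
    using that E(1) by (auto simp: nsets_def)
  have E'': "e \<subseteq> V2" if "e \<in> E2" for e
    using that E(2) by (auto simp: nsets_def)
  from side show ?thesis
  proof
    assume *: "insert w L \<subseteq> V1"
    have "f \<in> E1" if "f \<in> rotated_edges L u v w" for f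
      using e[OF that] * E'' E(3) subsetD[OF sub that] by blast
    with * show ?thesis by blast
  next
    assume *: "insert w L \<subseteq> V2"
    have "f \<in> E2" if "f \<in> rotated_edges L u v w" for f
      using e[OF that] * E' E(3) subsetD[OF sub that] by blast
    with * show ?thesis by blast
  qed
qed


section \<open>Cyclically shifted one-factorizations\<close>

text \<open>Round-robin tournament: \<open>{a, b}\<close> gets \<open>a + b\<close> and \<open>{a, q}\<close> gets \<open>2 * a\<close>, modulo \<open>q\<close>.\<close>

definition round_robin :: "nat \<Rightarrow> nat set \<Rightarrow> nat" where
  "round_robin q e = (\<Sum>e * (if q \<in> e then 2 else 1)) mod q"

text \<open>At a vertex \<open>a < q\<close> the edge to \<open>q\<close> gets the colour
  \<open>a + a\<close>, the one sum that no edge \<open>{a, b}\<close> with \<open>b < q\<close> and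
  \<open>b \<noteq> a\<close> can take. At the vertex \<open>q\<close> the colours are
  \<open>2 * b\<close>, which are distinct because 2 is invertible modulo the odd number
  \<open>q\<close>.\<close>

lemma round_robin_inj:
  assumes q: "odd q" and le: "a \<le> q" "b \<le> q" "d \<le> q" and ne: "b \<noteq> a" "d \<noteq> a"
    and eq: "round_robin q {a, b} = round_robin q {a, d}"
  shows "b = d"
proof -
  have cancel2: "x = y" if "[2 * x = 2 * y] (mod q)" "x < q" "y < q" for x y
    using that q by (metis cong_mult_lcancel_nat coprime_left_2_iff_odd cong_less_modulus_unique_nat)
  have cancel: "x = y" if "[a + x = a + y] (mod q)" "x < q" "y < q" for x y
    using that by (metis cong_add_lcancel_nat cong_less_modulus_unique_nat)
  have rr: "[round_robin q {x, y} = x + y] (mod q)" if "x < q" "y < q" "x \<noteq> y" for x y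
    using that by (simp add: round_robin_def cong_def)
  have rrq: "[round_robin q {x, q} = 2 * x] (mod q)" if "x < q" for x
    using that by (simp add: round_robin_def cong_def algebra_simps)
  consider "a = q" | "a < q" "b = q" "d = q" | "a < q" "b = q" "d < q" | "a < q" "b < q" "d = q"
    | "a < q" "b < q" "d < q"
    using le by linarith
  then show ?thesis
  proof cases
    case 1
    then have lt: "b < q" "d < q" using le ne by auto
    moreover have "round_robin q {b, q} = round_robin q {d, q}"
      using eq 1 by (simp add: insert_commute)
    ultimately have "[2 * b = 2 * d] (mod q)"
      using rrq[of b] rrq[of d] by (metis cong_sym cong_trans)
    then show ?thesis using cancel2 lt by blast
  next
    case 3
    then have "[a + a = a + d] (mod q)"
      using rrq[of a] rr[of a d] eq ne by (metis cong_sym cong_trans mult_2)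
    then show ?thesis using cancel 3 ne by blast
  next
    case 4
    then have "[a + a = a + b] (mod q)"
      using rrq[of a] rr[of a b] eq ne by (metis cong_sym cong_trans mult_2)
    then show ?thesis using cancel 4 ne by blast
  next
    case 5
    then have "[a + b = a + d] (mod q)"
      using rr[of a b] rr[of a d] eq ne by (metis cong_sym cong_trans)
    then show ?thesis using cancel 5 by blast
  qed auto
qed

lemma choose_two_double: "(2 * h) choose 2 = (2 * h - 1) * h"
  by (simp add: choose_two)

text \<open>Here \<open>j\<close> will be the class of a line and numbers below \<open>2 * h\<close>
  the roles of its points. A colour encodes a pair: the round-robin colour of an edge, and the
  position of the edge within that colour class, shifted cyclically by \<open>j\<close>. For fixed
  \<open>j\<close> the pair determines the edge. At a fixed vertex the first component determines
  the edge, and then the second determines the shift.\<close>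

lemma shifted_factorizations_exist:
  fixes h :: nat
  assumes h: "h \<ge> 1"
  obtains \<phi> :: "nat \<Rightarrow> nat set \<Rightarrow> nat" where
    "\<And>j. \<phi> j ` [{..<2*h}]\<^bsup>2\<^esup> \<subseteq> {1..(2*h) choose 2}"
    "\<And>j. inj_on (\<phi> j) ([{..<2*h}]\<^bsup>2\<^esup>)"
    "\<And>j k a b d. \<lbrakk>j < h; k < h; a < 2*h; b < 2*h; d < 2*h; b \<noteq> a; d \<noteq> a; \<phi> j {a, b} = \<phi> k {a, d}\<rbrakk>
       \<Longrightarrow> j = k \<and> b = d"
proof -
  define q where "q = 2 * h - 1"
  have q: "odd q" "q > 0" "2 * h = Suc q"
    using h by (auto simp: q_def)
  define A where "A = [{..<2*h}]\<^bsup>2\<^esup>"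
  define C where "C m = {e \<in> A. round_robin q e = m}" for m
  have finA: "finite A"
    by (simp add: A_def finite_imp_finite_nsets)
  \<comment> \<open>A colour class is a matching on \<open>2 * h\<close> vertices, so its edges can
    be numbered by positions below \<open>h\<close>.\<close>
  have "card (C m) \<le> h" for m
  proof -
    have fin: "finite (C m)"
      using finA by (simp add: C_def)
    have c2: "finite e" "card e = 2" if "e \<in> C m" for e
      using that by (auto simp: C_def A_def nsets_def)
    have "pairwise disjnt (C m)"
    proof (rule pairwiseI)
      fix e e' assume e: "e \<in> C m" "e' \<in> C m" "e \<noteq> e'"
      show "disjnt e e'"
      proof (rule ccontr)
        assume "\<not> disjnt e e'"
        then obtain a where a: "a \<in> e" "a \<in> e'" by (auto simp: disjnt_def)
        have "\<exists>b. f = {a, b} \<and> a \<le> q \<and> b \<le> q \<and> b \<noteq> a" if f: "f \<in> C m" "a \<in> f" for f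
        proof -
          have "f \<in> [{..<2*h}]\<^bsup>2\<^esup>" using f(1) by (simp add: C_def A_def)
          then obtain x y where xy: "f = {x, y}" "x < 2*h" "y < 2*h" "x \<noteq> y"
            by (auto elim!: nsets2_E)
          then show ?thesis
            using f(2) q(3) by (cases "a = x") (auto simp: less_Suc_eq_le)
        qed
        then obtain b d where "e = {a, b}" "e' = {a, d}" "a \<le> q" "b \<le> q" "b \<noteq> a" "d \<le> q" "d \<noteq> a"
          using e(1,2) a by metis
        moreover have "round_robin q e = round_robin q e'"
          using e by (simp add: C_def)
        ultimately show False
          using round_robin_inj[OF q(1)] e(3) by metis
      qed
    qed
    then have "card (\<Union>(C m)) = (\<Sum>e\<in>C m. card e)"
      using c2 by (intro card_Union_disjoint)
    also have "\<dots> = 2 * card (C m)"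
      using c2 by simp
    finally have "2 * card (C m) \<le> card {..<2*h}"
      using card_mono[of "{..<2*h}" "\<Union>(C m)"] by (auto simp: C_def A_def nsets_def)
    then show ?thesis by simp
  qed
  then have "\<exists>g. g ` C m \<subseteq> {..<h} \<and> inj_on g (C m)" for m
    using finA card_le_inj[of "C m" "{..<h}"] by (simp add: C_def)
  then obtain g where g: "\<And>m. g m ` C m \<subseteq> {..<h}" "\<And>m. inj_on (g m) (C m)"
    by metis
  define idx where "idx e = g (round_robin q e) e" for e
  have idx_lt: "idx e < h" if "e \<in> A" for e
    using that g(1)[of "round_robin q e"] by (auto simp: C_def idx_def)
  have idx_inj: "e = e'" if "e \<in> A" "e' \<in> A" "round_robin q e = round_robin q e'" "idx e = idx e'" for e e'
    using that g(2)[of "round_robin q e"] by (auto simp: C_def idx_def inj_on_def)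
  \<comment> \<open>The pair is written in base \<open>h\<close>; the summand 1 makes the colours
    start at 1 instead of 0.\<close>
  define \<phi> where "\<phi> j e = 1 + (round_robin q e * h + (idx e + j) mod h)" for j e
  have \<phi>_eqD: "round_robin q e = round_robin q e' \<and> (idx e + j) mod h = (idx e' + k) mod h"
    if "\<phi> j e = \<phi> k e'" for j k e e'
  proof -
    have "round_robin q e * h + (idx e + j) mod h = round_robin q e' * h + (idx e' + k) mod h" (is "?l = ?r")
      using that by (simp add: \<phi>_def)
    then have "?l div h = ?r div h" "?l mod h = ?r mod h"
      by simp_all
    then show ?thesis using h by simp
  qed
  have shift: "x = y" if "(x + i) mod h = (y + i) mod h" "x < h" "y < h" for x y i
    using that by (metis cong_add_rcancel_nat cong_def cong_less_modulus_unique_nat)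
  show ?thesis
  proof (rule that[of \<phi>])
    fix j
    have "\<phi> j e \<le> q * h" for e
    proof -
      have "round_robin q e < q" using q by (simp add: round_robin_def)
      then have "Suc (round_robin q e) * h \<le> q * h"
        by (intro mult_le_mono1) simp
      moreover have "(idx e + j) mod h < h" using h by simp
      ultimately show ?thesis by (simp add: \<phi>_def)
    qed
    then show "\<phi> j ` [{..<2*h}]\<^bsup>2\<^esup> \<subseteq> {1..(2*h) choose 2}"
      unfolding choose_two_double q_def[symmetric] by (auto simp: \<phi>_def)
    show "inj_on (\<phi> j) ([{..<2*h}]\<^bsup>2\<^esup>)"
      unfolding A_def[symmetric]
      using \<phi>_eqD shift idx_lt idx_inj by (meson inj_onI)
  next
    fix j k a b d
    assume *: "j < h" "k < h" "a < 2*h" "b < 2*h" "d < 2*h" "b \<noteq> a" "d \<noteq> a" "\<phi> j {a, b} = \<phi> k {a, d}"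
    have "b = d"
      using \<phi>_eqD[OF *(8)] round_robin_inj[of q a b d] q * by simp
    moreover have "j = k"
      using \<phi>_eqD[OF *(8)] \<open>b = d\<close> shift[of j "idx {a, b}" k] * by (simp add: add.commute)
    ultimately show "j = k \<and> b = d" by simp
  qed
qed


section \<open>Line spaces with rainbow lines\<close>

text \<open>That two points lie on at most one line is the case \<open>M = N\<close> of
  \<open>triangle\<close>. That \<open>r div 2\<close> lines pass through each point, for even
  \<open>r\<close>, follows by counting from \<open>all_colours\<close> and
  \<open>proper\<close>.\<close>

locale rainbow_line_space =
  fixes V :: "'a set" and lines :: "'a set set" and c :: "'a set \<Rightarrow> nat" and r :: nat
  assumes finite_points: "finite V"
    and r_ge_4: "r \<ge> 4"
    and line_subset: "L \<in> lines \<Longrightarrow> L \<subseteq> V"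
    and line_card: "L \<in> lines \<Longrightarrow> card L = r"
    and line_rainbow: "L \<in> lines \<Longrightarrow> inj_on c ([L]\<^bsup>2\<^esup>)"
    and line_colours: "L \<in> lines \<Longrightarrow> c ` [L]\<^bsup>2\<^esup> \<subseteq> {1..r choose 2}"
    and all_colours: "x \<in> V \<Longrightarrow> i \<in> {1..r choose 2} \<Longrightarrow>
      \<exists>L\<in>lines. \<exists>z\<in>L. x \<in> L \<and> z \<noteq> x \<and> c {x, z} = i"
    and proper: "\<lbrakk>L \<in> lines; M \<in> lines; {x, y} \<in> [L]\<^bsup>2\<^esup>; {x, z} \<in> [M]\<^bsup>2\<^esup>; c {x, y} = c {x, z}\<rbrakk>
      \<Longrightarrow> y = z"
    and triangle: "\<lbrakk>L \<in> lines; M \<in> lines; N \<in> lines; x \<noteq> y; y \<noteq> z; x \<noteq> z;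
      {x, y} \<subseteq> L; {y, z} \<subseteq> M; {x, z} \<subseteq> N\<rbrakk> \<Longrightarrow> z \<in> L"
begin

definition collinear_pairs :: "'a set set" where
  "collinear_pairs = (\<Union>L\<in>lines. [L]\<^bsup>2\<^esup>)"

lemma collinear_pairs_subset: "collinear_pairs \<subseteq> [V]\<^bsup>2\<^esup>"
  using line_subset nsets_mono unfolding collinear_pairs_def by blast

lemma collinear_pairsE:
  assumes "{x, y} \<in> collinear_pairs"
  obtains L where "L \<in> lines" "x \<in> L" "y \<in> L" "x \<noteq> y"
  using assms unfolding collinear_pairs_def by auto

lemma colours: "c ` collinear_pairs \<subseteq> {1..r choose 2}"
  using line_colours unfolding collinear_pairs_def by blast

text \<open>There are only as many colours as edges in a line, so a line minus an edge \<open>uv\<close> misses exactly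
  the colour of \<open>uv\<close>, and properness excludes any other edge of that colour at \<open>u\<close>.\<close>

lemma no_rainbow_copy:
  assumes H: "rotated_clique r H"
  shows "\<not> has_rainbow_copy H (V, collinear_pairs) c"
proof
  assume "has_rainbow_copy H (V, collinear_pairs) c"
  then obtain L u v w where L: "finite L" "card L = r" "u \<in> L" "v \<in> L" "u \<noteq> v" "w \<notin> L"
    and sub: "rotated_edges L u v w \<subseteq> collinear_pairs"
    and inj: "inj_on c (rotated_edges L u v w)"
    unfolding has_rainbow_copy_rotated_iff[OF H] by auto
  have clique: "{x, y} \<in> collinear_pairs" if "x \<in> L" "y \<in> L" "x \<noteq> y" "{x, y} \<noteq> {u, v}" for x y
    using that by (intro subsetD[OF sub]) (simp add: rotated_edges_def)
  \<comment> \<open>Two vertices \<open>p\<close> and \<open>q\<close> outside \<open>{u, v}\<close>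
    are joined to each other and to the rest of \<open>L\<close>, so every other vertex of
    \<open>L\<close> forms a triangle with them and lies on the line through \<open>p\<close> and
    \<open>q\<close>.\<close>
  have "card (L - {u, v}) \<ge> 2"
    using L r_ge_4 by (simp add: card_Diff_subset)
  then obtain p q where pq: "p \<in> L - {u, v}" "q \<in> L - {u, v}" "p \<noteq> q"
    using card_le_Suc0_iff_eq[of "L - {u, v}"] L(1) by auto
  then have "{p, q} \<in> collinear_pairs"
    by (intro clique) (auto simp: doubleton_eq_iff)
  then obtain M where M: "M \<in> lines" "p \<in> M" "q \<in> M"
    by (rule collinear_pairsE)
  have "z \<in> M" if z: "z \<in> L" for z
  proof (cases "z = p \<or> z = q")
    case False
    have "{q, z} \<in> collinear_pairs"
      using pq z False by (intro clique) (auto simp: doubleton_eq_iff)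
    then obtain M' where "M' \<in> lines" "{q, z} \<subseteq> M'"
      by (elim collinear_pairsE) simp
    moreover have "{p, z} \<in> collinear_pairs"
      using pq z False by (intro clique) (auto simp: doubleton_eq_iff)
    then obtain M'' where "M'' \<in> lines" "{p, z} \<subseteq> M''"
      by (elim collinear_pairsE) simp
    ultimately show ?thesis
      using triangle[of M M' M'' p q z] M pq(3) False by auto
  qed (use M in auto)
  then have "L \<subseteq> M" by blast
  moreover have "finite M"
    using M(1) line_subset finite_points finite_subset by blast
  ultimately have "L = M"
    using line_card[OF M(1)] L(2) card_subset_eq by blast
  then have line: "L \<in> lines" using M by simp
  have "card (c ` [L]\<^bsup>2\<^esup>) = r choose 2"
    using line_rainbow[OF line] L(2) by (simp add: card_image)
  then have surj: "c ` [L]\<^bsup>2\<^esup> = {1..r choose 2}"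
    using line_colours[OF line] by (intro card_subset_eq) auto
  have uw: "{u, w} \<in> rotated_edges L u v w" "{u, w} \<in> collinear_pairs"
    using sub by (auto simp: rotated_edges_def)
  then have "c {u, w} \<in> c ` [L]\<^bsup>2\<^esup>"
    using colours surj by auto
  then obtain e where e: "e \<in> [L]\<^bsup>2\<^esup>" "c e = c {u, w}"
    by (metis imageE)
  have "e \<noteq> {u, w}"
    using e(1) L(6) by auto
  then have "e = {u, v}"
    using inj e uw(1) by (auto simp: rotated_edges_def inj_on_def)
  moreover obtain N where "N \<in> lines" "{u, w} \<in> [N]\<^bsup>2\<^esup>"
    using uw(2) unfolding collinear_pairs_def by auto
  ultimately have "v = w"
    using proper[OF line] e by blast
  then show False using L by blast
qed

text \<open>Stated for an arbitrary host graph that contains the space, so that it covers both new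
  edges within \<open>V\<close> and new edges from \<open>V\<close> to the rest.\<close>

lemma new_edge_creates_copy:
  assumes H: "rotated_clique r H"
    and G: "V \<subseteq> verts G" "collinear_pairs \<subseteq> edges G"
    and c': "\<And>e. e \<in> collinear_pairs \<Longrightarrow> c' e = c e"
    and x: "x \<in> V" and y: "y \<in> verts G" "y \<noteq> x" "{x, y} \<notin> edges G"
  shows "has_rainbow_copy H (verts G, insert {x, y} (edges G)) (c'({x, y} := i))"
proof -
  \<comment> \<open>A colour \<open>i\<close> outside the range occurs on no line, so any line
    through \<open>x\<close> serves; the default 1 merely selects one.\<close>
  define k where "k = (if i \<in> {1..r choose 2} then i else 1)"
  have "r choose 2 \<ge> 1"
    using r_ge_4 by (simp add: Suc_le_eq zero_less_binomial)
  then have "k \<in> {1..r choose 2}"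
    by (simp add: k_def)
  then obtain L z where L: "L \<in> lines" "z \<in> L" "x \<in> L" "z \<noteq> x" "c {x, z} = k"
    using all_colours[OF x] by blast
  have LE: "[L]\<^bsup>2\<^esup> \<subseteq> collinear_pairs"
    using L(1) by (auto simp: collinear_pairs_def)
  have yL: "y \<notin> L"
    using L(3) LE G(2) y by (metis doubleton_in_nsets_2 subsetD)
  have i: "i \<notin> c ` ([L]\<^bsup>2\<^esup> - {{x, z}})"
  proof
    assume "i \<in> c ` ([L]\<^bsup>2\<^esup> - {{x, z}})"
    then obtain e where e: "e \<in> [L]\<^bsup>2\<^esup>" "e \<noteq> {x, z}" "c e = i" by blast
    then have "i = k"
      using line_colours[OF L(1)] by (auto simp: k_def)
    then show False
      using e L line_rainbow[OF L(1)] by (metis doubleton_in_nsets_2 inj_onD)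
  qed
  have xy: "{x, y} \<notin> [L]\<^bsup>2\<^esup>"
    using yL by simp
  have agree: "(c'({x, y} := i)) e = c e" if "e \<in> [L]\<^bsup>2\<^esup> - {{x, z}}" for e
  proof -
    have "e \<noteq> {x, y}" "c' e = c e"
      using that xy LE c' by blast+
    then show ?thesis by simp
  qed
  have "inj_on c ([L]\<^bsup>2\<^esup> - {{x, z}})"
    using line_rainbow[OF L(1)] by (rule inj_on_subset) blast
  then have "inj_on (c'({x, y} := i)) ([L]\<^bsup>2\<^esup> - {{x, z}})"
    using agree by (subst inj_on_cong[of _ _ c])
  moreover have "(c'({x, y} := i)) ` ([L]\<^bsup>2\<^esup> - {{x, z}}) = c ` ([L]\<^bsup>2\<^esup> - {{x, z}})"
    using agree by (rule image_cong[OF refl])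
  ultimately have "inj_on (c'({x, y} := i)) (rotated_edges L x z y)"
    using i xy by (simp add: rotated_edges_def)
  moreover have "finite L"
    using L(1) line_subset finite_points finite_subset by blast
  moreover have "rotated_edges L x z y \<subseteq> insert {x, y} (edges G)"
    using LE G by (auto simp: rotated_edges_def)
  moreover have "L \<subseteq> verts G"
    using line_subset[OF L(1)] G by blast
  ultimately show ?thesis
    unfolding has_rainbow_copy_rotated_iff[OF H] using L yL y(1) line_card[OF L(1)]
    by (intro exI[of _ L] exI[of _ x] exI[of _ z] exI[of _ y]) auto
qed

text \<open>A rainbow copy would be connected and hence lie in one of the two parts. A new edge
  within \<open>G\<close> is handled by the saturation of \<open>G\<close>; any other has an end in
  \<open>V\<close>, to which \<open>new_edge_creates_copy\<close> applies.\<close>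

lemma disjoint_union_saturated:
  assumes H: "rotated_clique r H" and t: "r choose 2 \<le> t"
    and sat: "rainbow_saturated t H G b" and disj: "verts G \<inter> V = {}"
  shows "\<exists>b'. rainbow_saturated t H (verts G \<union> V, edges G \<union> collinear_pairs) b'"
proof
  let ?U = "(verts G \<union> V, edges G \<union> collinear_pairs)"
  define b' where "b' e = (if e \<in> collinear_pairs then c e else b e)" for e
  have G: "finite (verts G)" "edges G \<subseteq> [verts G]\<^bsup>2\<^esup>" "b ` edges G \<subseteq> {1..t}"
    and noG: "\<not> has_rainbow_copy H G b"
    and satG: "\<And>e i. \<lbrakk>e \<in> [verts G]\<^bsup>2\<^esup> - edges G; i \<in> {1..t}\<rbrakk> \<Longrightarrow>
      has_rainbow_copy H (verts G, insert e (edges G)) (b(e := i))"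
    using sat by (auto simp: rainbow_saturated_def edge_coloured_def simple_graph_def)
  have dE: "e \<notin> collinear_pairs" if "e \<in> [verts G]\<^bsup>2\<^esup>" for e
  proof
    assume "e \<in> collinear_pairs"
    then have "e \<subseteq> verts G \<inter> V" "card e = 2"
      using that collinear_pairs_subset by (auto simp: nsets_def)
    then show False using disj by simp
  qed
  have b'G: "b' e = b e" if "e \<in> [verts G]\<^bsup>2\<^esup>" for e
    using dE[OF that] by (simp add: b'_def)
  have b'V: "b' e = c e" if "e \<in> collinear_pairs" for e
    using that by (simp add: b'_def)
  have "edge_coloured t ?U b'"
    unfolding edge_coloured_def simple_graph_def
  proof (intro conjI)
    show "finite (verts ?U)" using G finite_points by simp
    show "edges ?U \<subseteq> [verts ?U]\<^bsup>2\<^esup>"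
      using G(2) collinear_pairs_subset nsets_mono[of "verts G" "verts G \<union> V" 2]
        nsets_mono[of V "verts G \<union> V" 2] by auto
    have "c ` collinear_pairs \<subseteq> {1..t}"
      using colours t by (auto simp: image_subset_iff)
    then show "b' ` edges ?U \<subseteq> {1..t}"
      using G(3) by (auto simp: b'_def image_subset_iff)
  qed
  moreover have "\<not> has_rainbow_copy H ?U b'"
  proof
    assume "has_rainbow_copy H ?U b'"
    then obtain L u v w where L: "finite L" "card L = r" "u \<in> L" "v \<in> L" "u \<noteq> v" "w \<notin> L"
      and sub: "rotated_edges L u v w \<subseteq> edges G \<union> collinear_pairs"
      and inj: "inj_on b' (rotated_edges L u v w)"
      unfolding has_rainbow_copy_rotated_iff[OF H] by auto
    from rotated_edges_subset_Un[OF r_ge_4 L(2-) G(2) collinear_pairs_subset disj sub]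
    show False
    proof
      assume *: "insert w L \<subseteq> verts G \<and> rotated_edges L u v w \<subseteq> edges G"
      then have "inj_on b (rotated_edges L u v w)"
        using inj b'G G(2) by (subst inj_on_cong[of _ b b']) (auto simp: subset_iff)
      then show False
        using noG * L unfolding has_rainbow_copy_rotated_iff[OF H] by blast
    next
      assume *: "insert w L \<subseteq> V \<and> rotated_edges L u v w \<subseteq> collinear_pairs"
      then have "inj_on c (rotated_edges L u v w)"
        using inj b'V by (subst inj_on_cong[of _ c b']) (auto simp: subset_iff)
      then show False
        using no_rainbow_copy[OF H] * L unfolding has_rainbow_copy_rotated_iff[OF H] fst_conv snd_conv
        by blast
    qed
  qed
  moreover have "has_rainbow_copy H (verts ?U, insert e (edges ?U)) (b'(e := i))"
    if e: "e \<in> [verts ?U]\<^bsup>2\<^esup> - edges ?U" and i: "i \<in> {1..t}" for e i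
  proof (cases "e \<in> [verts G]\<^bsup>2\<^esup>")
    case True
    then obtain L u v w where L: "finite L" "card L = r" "u \<in> L" "v \<in> L" "u \<noteq> v" "w \<notin> L"
      and sub: "insert w L \<subseteq> verts G" "rotated_edges L u v w \<subseteq> insert e (edges G)"
      and inj: "inj_on (b(e := i)) (rotated_edges L u v w)"
      using satG[of e i] e i unfolding has_rainbow_copy_rotated_iff[OF H] by auto
    have "(b'(e := i)) f = (b(e := i)) f" if "f \<in> rotated_edges L u v w" for f
      using that sub(2) G(2) b'G by auto
    then have "inj_on (b'(e := i)) (rotated_edges L u v w)"
      using inj inj_on_cong[of "rotated_edges L u v w" "b'(e := i)" "b(e := i)"] by blast
    then show ?thesis
      unfolding has_rainbow_copy_rotated_iff[OF H] using L sub
      by (intro exI[of _ L] exI[of _ u] exI[of _ v] exI[of _ w]) auto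
  next
    case False
    then obtain x y where xy: "e = {x, y}" "x \<in> V" "y \<in> verts ?U" "y \<noteq> x"
      using e by (auto elim!: nsets2_E simp: insert_commute)
    have "has_rainbow_copy H (verts ?U, insert {x, y} (edges ?U)) (b'({x, y} := i))"
      by (rule new_edge_creates_copy[OF H]) (use xy e b'V in auto)
    then show ?thesis using xy by simp
  qed
  ultimately show "rainbow_saturated t H ?U b'"
    by (simp add: rainbow_saturated_def)
qed

end


section \<open>Existence of rainbow line spaces\<close>

text \<open>The points are pairs \<open>(a, S)\<close> of a role \<open>a < 2 * h\<close> and a tag \<open>S\<close>, a set of pairs \<open>(j, a)\<close> with \<open>j < h\<close>.
  The lines of the \<open>j\<close>-th class are the fibres of \<open>(a, S) \<mapsto> S \<triangle> {(j, a)}\<close>; over the two-element field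
  these shifts are linearly independent, so triangles occur only within lines.\<close>

lemma rainbow_line_space_exists:
  fixes V :: "'a set"
  assumes h: "h \<ge> 2" and finV: "finite V" and cardV: "card V = 2 * h * 2 ^ (h * (2 * h))"
  shows "\<exists>lines c. rainbow_line_space V lines c (2 * h)"
proof -
  define P where "P = {..<h} \<times> {..<2*h}"
  \<comment> \<open>The prescribed size is the number of pairs of a role and a tag, so the space can
    be carried over to any set of that size.\<close>
  have "card V = card ({..<2*h} \<times> Pow P)"
    by (simp add: cardV P_def card_cartesian_product card_Pow)
  then obtain g where g: "bij_betw g V ({..<2*h} \<times> Pow P)"
    using finite_same_card_bij[OF finV, of "{..<2*h} \<times> Pow P"] by (auto simp: P_def)
  define role where "role x = fst (g x)" for x
  define tag where "tag x = snd (g x)" for x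
  have role_lt: "role x < 2 * h" and tag_sub: "tag x \<subseteq> P" if "x \<in> V" for x
    using bij_betwE[OF g] that by (force simp: role_def tag_def)+
  have ext: "x = y" if "x \<in> V" "y \<in> V" "role x = role y" "tag x = tag y" for x y
    using that g by (metis bij_betw_inv_into_left prod.expand role_def tag_def)
  have point: "\<exists>x\<in>V. role x = a \<and> tag x = S" if "a < 2 * h" "S \<subseteq> P" for a S
  proof -
    have "(a, S) \<in> g ` V"
      using that g by (simp add: bij_betw_def)
    then show ?thesis by (metis fst_conv image_iff role_def snd_conv tag_def)
  qed
  define base where "base j x = sym_diff (tag x) {(j, role x)}" for j x
  define line where "line j T = {x \<in> V. base j x = T}" for j T
  define lines where "lines = {line j T |j T. j < h \<and> T \<subseteq> P}"
  have base_sub: "base j x \<subseteq> P" if "x \<in> V" "j < h" for j x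
    using tag_sub[OF that(1)] role_lt[OF that(1)] that(2) by (auto simp: base_def P_def)
  have tag_base: "tag x = sym_diff (base j x) {(j, role x)}" for j x
    by (auto simp: base_def)
  \<comment> \<open>The tag is recovered from the base and the role, so a point of a line is
    determined by its role.\<close>
  have role_inj: "role x \<noteq> role y" if "x \<in> V" "y \<in> V" "base j x = base j y" "x \<noteq> y" for x y j
    using that ext[of x y] tag_base[of x j] tag_base[of y j] by auto
  have base_iff: "(e \<in> tag x \<longleftrightarrow> e \<noteq> (j, role x)) \<longleftrightarrow> e \<in> base j x" for e j x
    by (auto simp: base_def)
  \<comment> \<open>The tags of two points on a line of class \<open>j\<close> differ exactly in
    \<open>(j, role x)\<close> and \<open>(j, role y)\<close>, and this difference reveals
    \<open>j\<close>.\<close>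
  have class_unique: "j = k"
    if "x \<in> V" "y \<in> V" "x \<noteq> y" "base j x = base j y" "base k x = base k y" for j k x y
  proof -
    have "role x \<noteq> role y" using role_inj that by blast
    then show ?thesis
      using base_iff[of "(j, role x)" x j] base_iff[of "(j, role x)" y j]
        base_iff[of "(j, role x)" x k] base_iff[of "(j, role x)" y k] that by auto
  qed
  have triangle: "j = k"
    if V: "x \<in> V" "y \<in> V" "z \<in> V" and ne: "x \<noteq> y" "y \<noteq> z" "x \<noteq> z"
      and eq: "base j x = base j y" "base k y = base k z" "base l x = base l z" for j k l x y z
  proof -
    have roles: "role x \<noteq> role y" "role y \<noteq> role z" "role x \<noteq> role z"
      using role_inj V ne eq by blast+
    \<comment> \<open>The three tag differences around the triangle sum to zero. The element
      \<open>(j, role y)\<close> of the first can only be cancelled by \<open>(k, role y)\<close>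
      from the second, since the three roles are distinct.\<close>
    have "(j, role y) \<in> base j x \<longleftrightarrow> (j, role y) \<in> base j y"
      "(j, role y) \<in> base k y \<longleftrightarrow> (j, role y) \<in> base k z"
      "(j, role y) \<in> base l x \<longleftrightarrow> (j, role y) \<in> base l z"
      using eq by auto
    then show ?thesis
      using roles unfolding base_def by auto
  qed

  obtain \<phi> :: "nat \<Rightarrow> nat set \<Rightarrow> nat" where
    \<phi>_range: "\<And>j. \<phi> j ` [{..<2*h}]\<^bsup>2\<^esup> \<subseteq> {1..(2*h) choose 2}" and
    \<phi>_inj: "\<And>j. inj_on (\<phi> j) ([{..<2*h}]\<^bsup>2\<^esup>)" and
    \<phi>_proper: "\<And>j k a b d. \<lbrakk>j < h; k < h; a < 2*h; b < 2*h; d < 2*h; b \<noteq> a; d \<noteq> a;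
      \<phi> j {a, b} = \<phi> k {a, d}\<rbrakk> \<Longrightarrow> j = k \<and> b = d"
    using shifted_factorizations_exist[of h] h by auto
  \<comment> \<open>Over all \<open>j\<close>, the vertex \<open>a\<close> has
    \<open>h * (2 * h - 1)\<close> edges with distinct colours, which is exactly the number of
    colours.\<close>
  have \<phi>_surj: "\<exists>j<h. \<exists>b<2*h. b \<noteq> a \<and> \<phi> j {a, b} = i"
    if a: "a < 2*h" and i: "i \<in> {1..(2*h) choose 2}" for a i
  proof -
    let ?D = "{..<h} \<times> ({..<2*h} - {a})"
    let ?f = "\<lambda>(j, b). \<phi> j {a, b}"
    have "inj_on ?f ?D"
    proof (rule inj_onI)
      fix p p' assume "p \<in> ?D" "p' \<in> ?D" "?f p = ?f p'"
      then show "p = p'"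
        using \<phi>_proper[of "fst p" "fst p'" a "snd p" "snd p'"] a by (cases p; cases p') simp
    qed
    then have "card (?f ` ?D) = (2*h) choose 2"
      using a by (simp add: card_image card_cartesian_product choose_two_double)
    moreover have "?f ` ?D \<subseteq> {1..(2*h) choose 2}"
    proof -
      have "\<phi> j {a, b} \<in> {1..(2*h) choose 2}" if "b < 2*h" "b \<noteq> a" for j b
        using a that by (intro subsetD[OF \<phi>_range[of j]] imageI) auto
      then show ?thesis by fastforce
    qed
    ultimately have "?f ` ?D = {1..(2*h) choose 2}"
      by (intro card_subset_eq) auto
    then have "i \<in> ?f ` ?D"
      using i by simp
    then obtain j b where "j < h" "b < 2*h" "b \<noteq> a" "\<phi> j {a, b} = i"
      by auto
    then show ?thesis by blast
  qed

  \<comment> \<open>All lines of a class share one colour pattern, transported by the roles. On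
    collinear pairs the choice is forced by \<open>class_unique\<close>.\<close>
  define c where "c e = \<phi> (SOME j. j < h \<and> (\<exists>T. e \<subseteq> line j T)) (role ` e)" for e
  have c: "c {x, y} = \<phi> j {role x, role y}"
    if "x \<in> V" "y \<in> V" "x \<noteq> y" "base j x = base j y" "j < h" for x y j
  proof -
    have "(SOME j. j < h \<and> (\<exists>T. {x, y} \<subseteq> line j T)) = j"
    proof (rule some_equality)
      show "j < h \<and> (\<exists>T. {x, y} \<subseteq> line j T)"
        using that by (auto simp: line_def)
      fix k assume "k < h \<and> (\<exists>T. {x, y} \<subseteq> line k T)"
      then have "base k x = base k y" by (auto simp: line_def)
      then show "k = j" using class_unique that by blast
    qed
    then show ?thesis by (simp add: c_def)
  qed
  have c_line: "c e = \<phi> j (role ` e) \<and> role ` e \<in> [{..<2*h}]\<^bsup>2\<^esup>"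
    if e: "e \<in> [line j T]\<^bsup>2\<^esup>" and j: "j < h" for e j T
  proof -
    obtain x y where xy: "e = {x, y}" "x \<in> line j T" "y \<in> line j T" "x \<noteq> y"
      using e by (rule nsets2_E)
    then show ?thesis
      using c[of x y j] j role_lt role_inj[of x y j] by (auto simp: line_def)
  qed
  have role_inj_on: "inj_on role (line j T)" for j T
    using role_inj by (fastforce simp: inj_on_def line_def)

  have "rainbow_line_space V lines c (2 * h)"
  proof
    show "finite V" by fact
    show "4 \<le> 2 * h" using h by simp
  next
    fix L assume "L \<in> lines"
    then obtain j T where L: "L = line j T" "j < h" "T \<subseteq> P"
      unfolding lines_def by blast
    show "L \<subseteq> V" by (auto simp: L line_def)
    \<comment> \<open>Each role \<open>a\<close> occurs on the line with base \<open>T\<close>, at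
      the point with tag \<open>T\<close> \<triangle> \<open>{(j, a)}\<close>.\<close>
    have "role ` L = {..<2*h}"
    proof
      show "role ` L \<subseteq> {..<2*h}" using role_lt by (auto simp: L line_def)
      show "{..<2*h} \<subseteq> role ` L"
      proof
        fix a assume a: "a \<in> {..<2*h}"
        then have "sym_diff T {(j, a)} \<subseteq> P"
          using L by (auto simp: P_def)
        then obtain x where "x \<in> V" "role x = a" "tag x = sym_diff T {(j, a)}"
          using point[of a "sym_diff T {(j, a)}"] a by auto
        then have "x \<in> L" by (auto simp: L line_def base_def)
        then show "a \<in> role ` L" using \<open>role x = a\<close> by blast
      qed
    qed
    then show "card L = 2 * h"
      using role_inj_on[of j T] L by (metis card_image card_lessThan)
    show "inj_on c ([L]\<^bsup>2\<^esup>)"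
    proof (rule inj_onI)
      fix e f assume ef: "e \<in> [L]\<^bsup>2\<^esup>" "f \<in> [L]\<^bsup>2\<^esup>" "c e = c f"
      then have "role ` e = role ` f"
        using c_line[of _ j T] L \<phi>_inj[of j] by (simp add: inj_on_def)
      moreover have "e \<subseteq> L" "f \<subseteq> L" using ef by (auto simp: nsets_def)
      ultimately show "e = f"
        using inj_on_image_eq_iff[OF role_inj_on[of j T]] L by blast
    qed
    show "c ` [L]\<^bsup>2\<^esup> \<subseteq> {1..(2*h) choose 2}"
      using c_line[of _ j T] L \<phi>_range[of j] by (auto simp: image_subset_iff)
  next
    fix x i assume x: "x \<in> V" and i: "i \<in> {1..(2*h) choose 2}"
    obtain j b where jb: "j < h" "b < 2*h" "b \<noteq> role x" "\<phi> j {role x, b} = i"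
      using \<phi>_surj[OF role_lt[OF x] i] by blast
    have "sym_diff (base j x) {(j, b)} \<subseteq> P"
      using base_sub[OF x jb(1)] jb by (auto simp: P_def)
    then obtain z where z: "z \<in> V" "role z = b" "tag z = sym_diff (base j x) {(j, b)}"
      using point jb(2) by blast
    have base: "base j z = base j x"
      unfolding base_def[of j z] using z by auto
    have "line j (base j x) \<in> lines"
      using base_sub[OF x jb(1)] jb(1) by (auto simp: lines_def)
    moreover have "z \<in> line j (base j x)" "x \<in> line j (base j x)" "z \<noteq> x"
      using x z base jb by (auto simp: line_def)
    moreover have "c {x, z} = i"
      using c[of x z j] x z base jb by auto
    ultimately show "\<exists>L\<in>lines. \<exists>z\<in>L. x \<in> L \<and> z \<noteq> x \<and> c {x, z} = i"
      by blast
  next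
    fix L M x y z
    assume LM: "L \<in> lines" "M \<in> lines" and xy: "{x, y} \<in> [L]\<^bsup>2\<^esup>" and xz: "{x, z} \<in> [M]\<^bsup>2\<^esup>"
      and eq: "c {x, y} = c {x, z}"
    obtain j where j: "j < h" "x \<in> V" "y \<in> V" "x \<noteq> y" "base j x = base j y"
      using LM xy by (auto simp: lines_def line_def)
    obtain k where k: "k < h" "z \<in> V" "x \<noteq> z" "base k x = base k z"
      using LM xz by (auto simp: lines_def line_def)
    have "\<phi> j {role x, role y} = \<phi> k {role x, role z}"
      using c[of x y j] c[of x z k] j k eq by simp
    \<comment> \<open>So \<open>y\<close> and \<open>z\<close> lie on the same line of class
      \<open>j\<close> through \<open>x\<close> and have the same role there.\<close>
    then have "j = k \<and> role y = role z"
      using \<phi>_proper role_lt role_inj[of x y j] role_inj[of x z k] j k by metis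
    then show "y = z"
      using role_inj[of y z j] j k by metis
  next
    fix L M N x y z
    assume LMN: "L \<in> lines" "M \<in> lines" "N \<in> lines" and ne: "x \<noteq> y" "y \<noteq> z" "x \<noteq> z"
      and on: "{x, y} \<subseteq> L" "{y, z} \<subseteq> M" "{x, z} \<subseteq> N"
    obtain j T where L: "L = line j T"
      using LMN(1) unfolding lines_def by blast
    obtain k where k: "base k y = base k z"
      using LMN(2) on(2) by (auto simp: lines_def line_def)
    obtain l where l: "base l x = base l z"
      using LMN(3) on(3) by (auto simp: lines_def line_def)
    have xy: "x \<in> V" "y \<in> V" "base j x = T" "base j y = T" and z: "z \<in> V"
      using on LMN(2) by (auto simp: L lines_def line_def)
    then have "j = k"
      using triangle[of x y z j k l] ne k l by simp
    then show "z \<in> L"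
      using xy z k by (simp add: L line_def)
  qed
  then show ?thesis by blast
qed


section \<open>Linearity of the saturation number\<close>

text \<open>A minimum saturated graph on \<open>n\<close> vertices is enlarged by a line space on
  \<open>N\<close> fresh vertices. The number of added edges is bounded crudely by that of all
  pairs; what counts is that neither \<open>N\<close> nor this bound depends on
  \<open>n\<close>.\<close>

lemma sat_add_bounded:
  assumes H: "rotated_clique (2 * h) H" and h: "h \<ge> 2" and t: "(2 * h) choose 2 \<le> t"
    and N: "N = 2 * h * 2 ^ (h * (2 * h))"
  shows "sat t (n + N) H \<le> sat t n H + (N choose 2)"
proof -
  have "edges H \<noteq> {}"
    using H by (auto simp: rotated_clique_altdef rotated_edges_def)
  then obtain G :: "nat ugraph" and b where G: "card (verts G) = n" "rainbow_saturated t H G b"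
    "card (edges G) = sat t n H"
    using sat_attained by blast
  have finG: "finite (verts G)"
    using G(2) by (simp add: rainbow_saturated_def edge_coloured_def simple_graph_def)
  then have "infinite (UNIV - verts G)"
    by (simp add: Diff_infinite_finite)
  then obtain V where V: "finite V" "card V = N" "V \<subseteq> UNIV - verts G"
    using infinite_arbitrarily_large by metis
  obtain lines c where "rainbow_line_space V lines c (2 * h)"
    using rainbow_line_space_exists[OF h V(1)] V(2) N by blast
  then interpret rainbow_line_space V lines c "2 * h" .
  have disj: "verts G \<inter> V = {}" using V by blast
  obtain b' where b': "rainbow_saturated t H (verts G \<union> V, edges G \<union> collinear_pairs) b'"
    using disjoint_union_saturated[OF H t G(2) disj] by blast
  have "card (verts G \<union> V) = n + N"
    using card_Un_disjoint[OF finG V(1) disj] G V by simp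
  then have "sat t (n + N) H \<le> card (edges G \<union> collinear_pairs)"
    unfolding sat_def using b' by (intro Least_le) fastforce
  also have "\<dots> \<le> card (edges G) + card collinear_pairs"
    by (rule card_Un_le)
  also have "card collinear_pairs \<le> N choose 2"
    using card_mono[OF _ collinear_pairs_subset] V by (simp add: finite_imp_finite_nsets)
  finally show ?thesis using G(3) by simp
qed

theorem theorem3p12:
  fixes r t :: nat and H :: "'b ugraph"
  assumes "r \<ge> 4" and "even r"
    and "rotated_clique r H"
    and "t \<ge> r choose 2"
  shows "(\<lambda>n. real (sat t n H)) \<in> O(\<lambda>n. real n)"
proof -
  obtain h where r: "r = 2 * h" using \<open>even r\<close> by blast
  define N :: nat where "N = 2 * h * 2 ^ (h * (2 * h))"
  define D where "D = N choose 2"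
  have "N > 0" using \<open>r \<ge> 4\<close> r by (simp add: N_def)
  have step: "sat t (n + N) H \<le> sat t n H + D" for n
    using sat_add_bounded[of h H t N n] assms r by (simp add: N_def D_def)
  have steps: "sat t (s + k * N) H \<le> sat t s H + k * D" for s k
  proof (induction k)
    case (Suc k)
    then show ?case using step[of "s + k * N"] by (simp add: algebra_simps)
  qed simp
  \<comment> \<open>Stepping down from \<open>n\<close> by multiples of \<open>N\<close> ends at the
    residue \<open>n mod N\<close>; the sum bounds all these starting values at once.\<close>
  define C where "C = (\<Sum>s<N. sat t s H)"
  have bound: "sat t n H \<le> C + n * D" for n
  proof -
    have "sat t n H \<le> sat t (n mod N) H + (n div N) * D"
      using steps[of "n mod N" "n div N"] by simp
    also have "sat t (n mod N) H \<le> C"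
      unfolding C_def using \<open>N > 0\<close> by (intro member_le_sum) auto
    also have "n div N * D \<le> n * D" by simp
    finally show ?thesis by simp
  qed
  have "norm (real (sat t n H)) \<le> real (C + D) * norm (real n)" if "n \<ge> 1" for n
  proof -
    have "C \<le> C * n"
      using that by simp
    then have "sat t n H \<le> (C + D) * n"
      unfolding add_mult_distrib using bound[of n] mult.commute[of n D] by linarith
    then show ?thesis
      by (metis norm_of_nat of_nat_le_iff of_nat_mult)
  qed
  then show ?thesis
    by (intro bigoI[of _ "real (C + D)"] eventually_at_top_linorderI[of 1])
qed

end
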